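(* Let $S$ be a monoid and let $A$ be an $S$-act. Then $A$ is a Fitting $S$-act if and only if $A$ is both strongly Hopfian and strongly co-Hopfian.
   Context: $S$-acts are unitary right acts (nonempty sets) over the monoid $S$; natural numbers are positive integers. $\mathrm{End}(A)$ is the set of $S$-endomorphisms of $A$. A congruence on $A$ is an equivalence relation $\rho$ with $a\,\rho\,b \Rightarrow as\,\rho\,bs$ for all $s\in S$; $\Delta_A=\{(a,a)\mid a\in A\}$ and $\bigtriangledown_A=A\times A$. For a subact $B$ of $A$, the Rees congruence is $\rho_B=(B\times B)\cup\Delta_A$. For $f\in \mathrm{End}(A)$, $\ker f=\{(a,b)\in A\times A\mid f(a)=f(b)\}$, and $\mathcal{K}_{\mathrm{Im} f^n}=\rho_{\mathrm{Im} f^n}$. The join $\vee$ is taken in the lattice of congruences on $A$. $A$ is strongly Hopfian (resp. strongly co-Hopfian) if for every $f\in\mathrm{End}(A)$ the ascending chain $\ker f\subseteq\ker f^2\subseteq\ker f^3\subseteq\cdots$ (resp. the descending chain $\mathrm{Im} f\supseteq \mathrm{Im} f^2\supseteq\mathrm{Im} f^3\supseteq\cdots$) is stationary. $A$ is a Fitting act if for every $f\in\mathrm{End}(A)$ there exists a natural number $n$ such that $\ker f^n\vee\mathcal{K}_{\mathrm{Im} f^n}=\bigtriangledown_A$ and $\ker f^n\cap\mathcal{K}_{\mathrm{Im} f^n}=\Delta_A$. *)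

theory Defs
  imports "HOL-Algebra.Group" "HOL-Algebra.Complete_Lattice"
begin

locale right_act = monoid S
  for S :: "('s, 'x) monoid_scheme" (structure)
    and A :: "'a set"
    and act :: "'a \<Rightarrow> 's \<Rightarrow> 'a" (infixl \<open>\<cdot>\<close> 70) +
  assumes nonempty: "A \<noteq> {}"
    and act_closed: "\<lbrakk>a \<in> A; s \<in> carrier S\<rbrakk> \<Longrightarrow> a \<cdot> s \<in> A"
    and act_mult: "\<lbrakk>a \<in> A; s \<in> carrier S; t \<in> carrier S\<rbrakk> \<Longrightarrow> a \<cdot> (s \<otimes> t) = a \<cdot> s \<cdot> t"
    and act_one: "a \<in> A \<Longrightarrow> a \<cdot> \<one> = a"

text \<open>As for \<^const>\<open>hom\<close> in HOL-Algebra, an endomorphism is not required to be extensional: its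
  values outside \<^term>\<open>A\<close> are arbitrary, and kernels and images below are taken relative to
  \<^term>\<open>A\<close>.\<close>

definition act_End :: "('s, 'x) monoid_scheme \<Rightarrow> 'a set \<Rightarrow> ('a \<Rightarrow> 's \<Rightarrow> 'a) \<Rightarrow> ('a \<Rightarrow> 'a) set"
  where "act_End S A act =
    {f \<in> A \<rightarrow> A. \<forall>a\<in>A. \<forall>s\<in>carrier S. f (act a s) = act (f a) s}"

definition act_congruence ::
    "('s, 'x) monoid_scheme \<Rightarrow> 'a set \<Rightarrow> ('a \<Rightarrow> 's \<Rightarrow> 'a) \<Rightarrow> ('a \<times> 'a) set \<Rightarrow> bool"
  where "act_congruence S A act \<rho> \<longleftrightarrow>
    equiv A \<rho> \<and> (\<forall>(a, b)\<in>\<rho>. \<forall>s\<in>carrier S. (act a s, act b s) \<in> \<rho>)"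

definition congruence_lattice ::
    "('s, 'x) monoid_scheme \<Rightarrow> 'a set \<Rightarrow> ('a \<Rightarrow> 's \<Rightarrow> 'a) \<Rightarrow> ('a \<times> 'a) set gorder"
  where "congruence_lattice S A act =
    \<lparr>carrier = {\<rho>. act_congruence S A act \<rho>}, eq = (=), le = (\<subseteq>)\<rparr>"

definition subact ::
    "('s, 'x) monoid_scheme \<Rightarrow> 'a set \<Rightarrow> ('a \<Rightarrow> 's \<Rightarrow> 'a) \<Rightarrow> 'a set \<Rightarrow> bool"
  where "subact S A act B \<longleftrightarrow>
    B \<noteq> {} \<and> B \<subseteq> A \<and> (\<forall>b\<in>B. \<forall>s\<in>carrier S. act b s \<in> B)"

definition rees_congruence :: "'a set \<Rightarrow> 'a set \<Rightarrow> ('a \<times> 'a) set"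
  where "rees_congruence A B = B \<times> B \<union> Id_on A"

definition act_ker :: "'a set \<Rightarrow> ('a \<Rightarrow> 'a) \<Rightarrow> ('a \<times> 'a) set"
  where "act_ker A f = {(a, b) \<in> A \<times> A. f a = f b}"

text \<open>Natural numbers are positive here, so chains start at index 1. In \<open>fitting_act\<close> below the
  condition \<^term>\<open>n \<ge> (1::nat)\<close> is essential: the choice \<^term>\<open>n = (0::nat)\<close> would satisfy the
  requirements for every endomorphism.\<close>

definition stationary :: "(nat \<Rightarrow> 'b) \<Rightarrow> bool"
  where "stationary X \<longleftrightarrow> (\<exists>n\<ge>1. \<forall>m\<ge>n. X m = X n)"

definition strongly_Hopfian ::
    "('s, 'x) monoid_scheme \<Rightarrow> 'a set \<Rightarrow> ('a \<Rightarrow> 's \<Rightarrow> 'a) \<Rightarrow> bool"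
  where "strongly_Hopfian S A act \<longleftrightarrow>
    (\<forall>f\<in>act_End S A act. stationary (\<lambda>n. act_ker A (f ^^ n)))"

definition strongly_co_Hopfian ::
    "('s, 'x) monoid_scheme \<Rightarrow> 'a set \<Rightarrow> ('a \<Rightarrow> 's \<Rightarrow> 'a) \<Rightarrow> bool"
  where "strongly_co_Hopfian S A act \<longleftrightarrow>
    (\<forall>f\<in>act_End S A act. stationary (\<lambda>n. (f ^^ n) ` A))"

definition fitting_act ::
    "('s, 'x) monoid_scheme \<Rightarrow> 'a set \<Rightarrow> ('a \<Rightarrow> 's \<Rightarrow> 'a) \<Rightarrow> bool"
  where "fitting_act S A act \<longleftrightarrow>
    (\<forall>f\<in>act_End S A act. \<exists>n\<ge>1.
      act_ker A (f ^^ n) \<squnion>\<^bsub>congruence_lattice S A act\<^esub> rees_congruence A ((f ^^ n) ` A) = A \<times> A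
      \<and> act_ker A (f ^^ n) \<inter> rees_congruence A ((f ^^ n) ` A) = Id_on A)"

text \<open>The join in \<open>fitting_act\<close> is the library's least upper bound, obtained by \<open>SOME\<close>. The
  following facts show that it is meaningful: the congruences form a complete lattice, and both
  arguments of the join are congruences.\<close>

context right_act
begin

lemma complete_lattice_congruences: "complete_lattice (congruence_lattice S A act)"
  (is "complete_lattice ?L")
proof -
  interpret partial_order ?L
    by standard (auto simp: congruence_lattice_def)
  show ?thesis
  proof (rule complete_lattice_criterion1)
    have "act_congruence S A act (A \<times> A)"
      by (auto simp: act_congruence_def equiv_def refl_on_def sym_def trans_def act_closed)
    then show "\<exists>g. greatest ?L g (carrier ?L)"
      by (intro exI[of _ "A \<times> A"])
        (auto simp: greatest_def congruence_lattice_def act_congruence_def equiv_def)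
  next
    fix R assume R: "R \<subseteq> carrier ?L" "R \<noteq> {}"
    then have *: "\<And>\<rho>. \<rho> \<in> R \<Longrightarrow> act_congruence S A act \<rho>"
      by (auto simp: congruence_lattice_def)
    have "equiv A (\<Inter>R)"
    proof (rule equivI)
      show "\<Inter>R \<subseteq> A \<times> A"
        using * R(2) unfolding act_congruence_def equiv_def by blast
      show "refl_on A (\<Inter>R)"
        using * unfolding act_congruence_def equiv_def refl_on_def by blast
      show "sym (\<Inter>R)"
        using * unfolding act_congruence_def equiv_def sym_def by blast
      show "trans (\<Inter>R)"
        using * unfolding act_congruence_def equiv_def trans_def by blast
    qed
    then have "act_congruence S A act (\<Inter>R)"
      using * unfolding act_congruence_def by blast
    then show "\<exists>i. greatest ?L i (Lower ?L R)"
      using R by (intro exI[of _ "\<Inter>R"])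
        (auto simp: greatest_def Lower_def congruence_lattice_def)
  qed
qed

lemma End_pow: "f \<in> act_End S A act \<Longrightarrow> f ^^ n \<in> act_End S A act"
proof (induction n)
  case (Suc n)
  then show ?case by (auto simp: act_End_def Pi_iff)
qed (auto simp: act_End_def)

lemma subact_image: "f \<in> act_End S A act \<Longrightarrow> subact S A act (f ` A)"
  unfolding subact_def
proof (intro conjI ballI)
  assume f: "f \<in> act_End S A act"
  show "f ` A \<noteq> {}" using nonempty by simp
  show "f ` A \<subseteq> A" using f by (auto simp: act_End_def)
  fix b s assume "b \<in> f ` A" and s: "s \<in> carrier S"
  then obtain a where a: "a \<in> A" "b = f a" by blast
  then have "b \<cdot> s = f (a \<cdot> s)" using f s by (simp add: act_End_def)
  then show "b \<cdot> s \<in> f ` A" using a s act_closed by blast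
qed

lemma congruence_ker: "f \<in> act_End S A act \<Longrightarrow> act_congruence S A act (act_ker A f)"
  unfolding act_congruence_def equiv_def
  by (intro conjI)
    (auto simp: act_ker_def act_End_def act_closed intro!: refl_onI symI transI)

lemma congruence_rees: "subact S A act B \<Longrightarrow> act_congruence S A act (rees_congruence A B)"
  unfolding act_congruence_def equiv_def
  by (intro conjI)
    (auto simp: rees_congruence_def subact_def act_closed intro!: refl_onI symI transI)

end

end

theory Submission
  imports Defs
begin

text \<open>For an endomorphism \<open>g\<close>, the relation
  \<open>g a = g b \<or> g a, g b \<in> Im g\<^sup>2\<close> is a congruence above both \<open>ker g\<close> and the Rees congruence
  of \<open>Im g\<close>, and any congruence above both contains it. Hence their join is universal iff
  \<open>Im g = Im g\<^sup>2\<close>, while their meet is trivial iff \<open>g\<close> is injective on \<open>Im g\<close>, that is,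
  iff \<open>ker g = ker g\<^sup>2\<close>. With \<open>g = f\<^sup>n\<close> these two conditions say exactly that the
  image and kernel chains of \<open>f\<close> are constant from \<open>n\<close> on.\<close>

lemma funpow_in_funcset: "f \<in> A \<rightarrow> A \<Longrightarrow> f ^^ n \<in> A \<rightarrow> A"
  by (induction n) auto

lemma act_ker_Int_rees_congruence_image_iff:
  assumes "g \<in> A \<rightarrow> A"
  shows "act_ker A g \<inter> rees_congruence A (g ` A) = Id_on A \<longleftrightarrow> inj_on g (g ` A)"
proof
  assume *: "act_ker A g \<inter> rees_congruence A (g ` A) = Id_on A"
  show "inj_on g (g ` A)"
  proof (rule inj_onI)
    fix x y assume "x \<in> g ` A" "y \<in> g ` A" "g x = g y"
    with assms have "(x, y) \<in> act_ker A g \<inter> rees_congruence A (g ` A)"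
      by (auto simp: act_ker_def rees_congruence_def)
    with * show "x = y" by (auto simp: Id_on_def)
  qed
next
  assume "inj_on g (g ` A)"
  then show "act_ker A g \<inter> rees_congruence A (g ` A) = Id_on A"
    by (auto simp: act_ker_def rees_congruence_def dest: inj_onD)
qed

text \<open>Each induction step cancels one \<open>f\<close>: on the image of \<open>f ^^ n\<close>,
  \<open>f\<close> is injective because its power \<open>f ^^ n\<close> is.\<close>

lemma act_ker_funpow_eqI:
  assumes f: "f \<in> A \<rightarrow> A" and "n \<ge> 1" and inj: "inj_on (f ^^ n) ((f ^^ n) ` A)" and "m \<ge> n"
  shows "act_ker A (f ^^ m) = act_ker A (f ^^ n)"
  using \<open>m \<ge> n\<close>
proof (induction m rule: dec_induct)
  case (step m)
  have "(f ^^ m) a = (f ^^ m) b"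
    if a: "a \<in> A" and b: "b \<in> A" and eq: "(f ^^ Suc m) a = (f ^^ Suc m) b" for a b
  proof -
    \<comment> \<open>Splitting \<open>m\<close> as \<open>n + (m - n)\<close> places
      \<open>(f ^^ m) a\<close> and \<open>(f ^^ m) b\<close> in the image of \<open>f ^^ n\<close>,
      where injectivity is available.\<close>
    define c d where "c = (f ^^ (m - n)) a" and "d = (f ^^ (m - n)) b"
    have "c \<in> A" "d \<in> A"
      using a b funpow_in_funcset[OF f] by (auto simp: c_def d_def)
    have m: "(f ^^ m) a = (f ^^ n) c" "(f ^^ m) b = (f ^^ n) d"
      using \<open>n \<le> m\<close> funpow_add[of n "m - n" f] by (simp_all add: c_def d_def)
    \<comment> \<open>As \<open>n \<ge> 1\<close>, one factor \<open>f\<close> can be peeled off.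
      Since \<open>f ((f ^^ n) c)\<close> is \<open>(f ^^ Suc m) a\<close>, and likewise for
      \<open>d\<close> and \<open>b\<close>, \<open>eq\<close> then applies.\<close>
    have pow: "(f ^^ n) ((f ^^ n) x) = (f ^^ (n - 1)) (f ((f ^^ n) x))" for x
      using \<open>n \<ge> 1\<close> funpow_swap1[of f "n - 1"] by (cases n) simp_all
    have "(f ^^ n) ((f ^^ n) c) = (f ^^ n) ((f ^^ n) d)"
      using eq m by (simp add: pow)
    with inj \<open>c \<in> A\<close> \<open>d \<in> A\<close> m show ?thesis by (auto dest: inj_onD)
  qed
  then have "act_ker A (f ^^ Suc m) = act_ker A (f ^^ m)"
    by (auto simp: act_ker_def)
  with step.IH show ?case by (rule trans[rotated])
qed simp

text \<open>It suffices that \<open>f\<close> maps the image of \<open>f ^^ n\<close> onto itself.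
  It maps into it because \<open>f\<close> commutes with \<open>f ^^ n\<close>, and onto it because
  the image of \<open>f ^^ (n + n)\<close> lies in that of \<open>f ^^ Suc n\<close> when
  \<open>n \<ge> 1\<close>.\<close>

lemma funpow_image_eqI:
  assumes f: "f \<in> A \<rightarrow> A" and "n \<ge> 1" and sub: "(f ^^ n) ` A \<subseteq> (f ^^ n) ` (f ^^ n) ` A"
    and "m \<ge> n"
  shows "(f ^^ m) ` A = (f ^^ n) ` A"
  using \<open>m \<ge> n\<close>
proof (induction m rule: dec_induct)
  case (step m)
  have "(f ^^ Suc m) ` A = f ` (f ^^ n) ` A"
    using step.IH by (metis funpow.simps(2) image_comp)
  also have "\<dots> = (f ^^ n) ` A"
  proof
    show "f ` (f ^^ n) ` A \<subseteq> (f ^^ n) ` A"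
      using f by (auto simp: funpow_swap1[of f n])
    have "(f ^^ n) ((f ^^ n) y) = f ((f ^^ n) ((f ^^ (n - 1)) y))" for y
    proof -
      have "n + n = Suc (n + (n - 1))" using \<open>n \<ge> 1\<close> by simp
      then show ?thesis by (metis comp_apply funpow.simps(2) funpow_add)
    qed
    moreover have "(f ^^ (n - 1)) y \<in> A" if "y \<in> A" for y
      using that funpow_in_funcset[OF f] by auto
    ultimately have "(f ^^ n) ` (f ^^ n) ` A \<subseteq> f ` (f ^^ n) ` A"
      by auto
    with sub show "(f ^^ n) ` A \<subseteq> f ` (f ^^ n) ` A"
      by (rule order_trans)
  qed
  finally show ?case .
qed simp

text \<open>Injectivity says that the kernel of \<open>f ^^ (n + n)\<close> lies in that of
  \<open>f ^^ n\<close>; the other inclusion always holds.\<close>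

lemma inj_on_funpow_image_iff:
  "inj_on (f ^^ n) ((f ^^ n) ` A) \<longleftrightarrow> act_ker A (f ^^ (n + n)) = act_ker A (f ^^ n)"
  by (auto simp: inj_on_def act_ker_def funpow_add set_eq_iff)

text \<open>The kernel and image chains may stabilise at different indices, while the Fitting
  condition asks for a single one; the maximum serves both.\<close>

lemma stationary_common_index:
  assumes "stationary X" "stationary Y"
  obtains n where "n \<ge> 1" "\<And>m. m \<ge> n \<Longrightarrow> X m = X n" "\<And>m. m \<ge> n \<Longrightarrow> Y m = Y n"
proof -
  obtain i where i: "i \<ge> 1" "\<And>m. m \<ge> i \<Longrightarrow> X m = X i"
    using assms(1) by (auto simp: stationary_def)
  obtain j where j: "\<And>m. m \<ge> j \<Longrightarrow> Y m = Y j"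
    using assms(2) by (auto simp: stationary_def)
  show thesis
  proof (rule that[of "max i j"])
    show "max i j \<ge> 1" using i(1) by simp
    show "X m = X (max i j)" if "m \<ge> max i j" for m
      using that i(2)[of m] i(2)[of "max i j"] by simp
    show "Y m = Y (max i j)" if "m \<ge> max i j" for m
      using that j[of m] j[of "max i j"] by simp
  qed
qed

context right_act
begin

text \<open>Pulling back along \<open>g\<close> produces the upper bound used to estimate the join
  from above.\<close>

lemma congruence_vimage:
  assumes g: "g \<in> act_End S A act" and \<rho>: "act_congruence S A act \<rho>"
  shows "act_congruence S A act {(a, b) \<in> A \<times> A. (g a, g b) \<in> \<rho>}"
proof -
  have "equiv A \<rho>" and comp: "\<And>a b s. (a, b) \<in> \<rho> \<Longrightarrow> s \<in> carrier S \<Longrightarrow> (a \<cdot> s, b \<cdot> s) \<in> \<rho>"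
    using \<rho> by (auto simp: act_congruence_def)
  then have "refl_on A \<rho>" "sym \<rho>" "trans \<rho>"
    by (auto simp: equiv_def)
  then have "equiv A {(a, b) \<in> A \<times> A. (g a, g b) \<in> \<rho>}"
    using g by (intro equivI)
      (auto simp: act_End_def Pi_iff intro!: refl_onI symI transI
        dest: refl_onD symD transD)
  then show ?thesis
    using g comp by (auto simp: act_congruence_def act_End_def act_closed)
qed

lemma join_ker_rees_image_iff:
  assumes g: "g \<in> act_End S A act"
  shows "act_ker A g \<squnion>\<^bsub>congruence_lattice S A act\<^esub> rees_congruence A (g ` A) = A \<times> A
    \<longleftrightarrow> g ` A \<subseteq> g ` g ` A"
    (is "?J = _ \<longleftrightarrow> _")
proof -
  let ?L = "congruence_lattice S A act"
  interpret L: complete_lattice ?L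
    by (rule complete_lattice_congruences)
  have gA: "g \<in> A \<rightarrow> A" using g by (simp add: act_End_def)
  have sub: "subact S A act (g ` A)" using g by (rule subact_image)
  have ker: "act_ker A g \<in> carrier ?L"
    using congruence_ker[OF g] by (simp add: congruence_lattice_def)
  have rees: "rees_congruence A (g ` A) \<in> carrier ?L"
    using congruence_rees[OF sub] by (simp add: congruence_lattice_def)
  have J: "act_congruence S A act ?J"
    using L.join_closed[OF ker rees] by (simp add: congruence_lattice_def)
  have kerJ: "act_ker A g \<subseteq> ?J"
    using L.join_left[OF ker rees] by (simp add: congruence_lattice_def)
  have reesJ: "rees_congruence A (g ` A) \<subseteq> ?J"
    using L.join_right[OF ker rees] by (simp add: congruence_lattice_def)
  show ?thesis
  proof
    assume univ: "?J = A \<times> A"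
    have "subact S A act (g ` g ` A)"
      using subact_image[OF End_pow[OF g, of 2]] by (simp add: numeral_2_eq_2 image_comp)
    define \<sigma> where "\<sigma> = {(a, b) \<in> A \<times> A. (g a, g b) \<in> rees_congruence A (g ` g ` A)}"
    have "act_congruence S A act \<sigma>"
      unfolding \<sigma>_def using congruence_vimage[OF g congruence_rees] \<open>subact S A act (g ` g ` A)\<close> .
    moreover have "act_ker A g \<subseteq> \<sigma>" "rees_congruence A (g ` A) \<subseteq> \<sigma>"
      using gA by (auto simp: \<sigma>_def act_ker_def rees_congruence_def Pi_iff)
    ultimately have "?J \<subseteq> \<sigma>"
      using L.join_le[of "act_ker A g" \<sigma> "rees_congruence A (g ` A)"] ker rees
      by (simp add: congruence_lattice_def)
    show "g ` A \<subseteq> g ` g ` A"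
    proof (rule image_subsetI)
      fix a assume "a \<in> A"
      \<comment> \<open>The pair \<open>(a, g a)\<close> is the test case: either alternative in
        \<sigma> puts \<open>g a\<close> into \<open>g\<close> g \<open>A\<close>.\<close>
      with gA have "(a, g a) \<in> \<sigma>"
        using univ \<open>?J \<subseteq> \<sigma>\<close> by auto
      then have "g a = g (g a) \<or> g a \<in> g ` g ` A"
        by (auto simp: \<sigma>_def rees_congruence_def)
      with \<open>a \<in> A\<close> show "g a \<in> g ` g ` A"
        by (metis imageI)
    qed
  next
    assume im: "g ` A \<subseteq> g ` g ` A"
    have "equiv A ?J" using J by (simp add: act_congruence_def)
    then have "?J \<subseteq> A \<times> A" "sym ?J" "trans ?J" by (auto simp: equiv_def)
    \<comment> \<open>The kernel links every point to the image, and the Rees congruence collapses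
      the image to one class, so any \<open>a\<close> and \<open>b\<close> are linked through
      \<open>g x\<close> and \<open>g y\<close>.\<close>
    have to_image: "\<exists>x\<in>A. (a, g x) \<in> ?J" if "a \<in> A" for a
    proof -
      obtain x where "x \<in> A" "g a = g (g x)" using im \<open>a \<in> A\<close> by blast
      then have "(a, g x) \<in> act_ker A g"
        using gA \<open>a \<in> A\<close> by (auto simp: act_ker_def)
      with kerJ \<open>x \<in> A\<close> show ?thesis by blast
    qed
    have "(a, b) \<in> ?J" if ab: "a \<in> A" "b \<in> A" for a b
    proof -
      obtain x y where "x \<in> A" "(a, g x) \<in> ?J" "y \<in> A" "(b, g y) \<in> ?J"
        using to_image[OF ab(1)] to_image[OF ab(2)] by blast
      moreover from this have "(g x, g y) \<in> ?J"
        using reesJ by (auto simp: rees_congruence_def)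
      ultimately show ?thesis
        using \<open>sym ?J\<close> \<open>trans ?J\<close> by (meson symD transD)
    qed
    with \<open>?J \<subseteq> A \<times> A\<close> show "?J = A \<times> A" by auto
  qed
qed

text \<open>This removes the congruence lattice: what remains concerns only the iterates of
  \<open>f\<close>.\<close>

lemma fitting_act_iff:
  "fitting_act S A act \<longleftrightarrow>
    (\<forall>f\<in>act_End S A act. \<exists>n\<ge>1.
      (f ^^ n) ` A \<subseteq> (f ^^ n) ` (f ^^ n) ` A \<and> inj_on (f ^^ n) ((f ^^ n) ` A))"
proof -
  have "f ^^ n \<in> A \<rightarrow> A" if "f \<in> act_End S A act" for f n
    using End_pow[OF that] by (simp add: act_End_def)
  then show ?thesis
    by (simp add: fitting_act_def join_ker_rees_image_iff End_pow
        act_ker_Int_rees_congruence_image_iff cong: ball_cong)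
qed

end

theorem theorem3p5:
  fixes S :: "('s, 'x) monoid_scheme" and A :: "'a set" and act :: "'a \<Rightarrow> 's \<Rightarrow> 'a"
  assumes "right_act S A act"
  shows "fitting_act S A act \<longleftrightarrow> strongly_Hopfian S A act \<and> strongly_co_Hopfian S A act"
proof -
  interpret right_act S A act by (rule assms)
  show ?thesis
  proof
    assume fitting: "fitting_act S A act"
    have "stationary (\<lambda>n. act_ker A (f ^^ n)) \<and> stationary (\<lambda>n. (f ^^ n) ` A)"
      if f: "f \<in> act_End S A act" for f
    proof -
      have fA: "f \<in> A \<rightarrow> A" using f by (simp add: act_End_def)
      obtain n where n: "n \<ge> 1" "(f ^^ n) ` A \<subseteq> (f ^^ n) ` (f ^^ n) ` A"
          "inj_on (f ^^ n) ((f ^^ n) ` A)"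
        using fitting f unfolding fitting_act_iff by blast
      show ?thesis
        unfolding stationary_def
        using n(1) act_ker_funpow_eqI[OF fA n(1,3)] funpow_image_eqI[OF fA n(1,2)] by blast
    qed
    then show "strongly_Hopfian S A act \<and> strongly_co_Hopfian S A act"
      by (simp add: strongly_Hopfian_def strongly_co_Hopfian_def)
  next
    assume hopf: "strongly_Hopfian S A act \<and> strongly_co_Hopfian S A act"
    show "fitting_act S A act"
      unfolding fitting_act_iff
    proof
      fix f assume "f \<in> act_End S A act"
      with hopf have "stationary (\<lambda>n. act_ker A (f ^^ n))" "stationary (\<lambda>n. (f ^^ n) ` A)"
        by (auto simp: strongly_Hopfian_def strongly_co_Hopfian_def)
      then obtain n where n: "n \<ge> 1" "\<And>m. m \<ge> n \<Longrightarrow> act_ker A (f ^^ m) = act_ker A (f ^^ n)"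
          "\<And>m. m \<ge> n \<Longrightarrow> (f ^^ m) ` A = (f ^^ n) ` A"
        by (rule stationary_common_index) blast
      \<comment> \<open>Both elementary conditions come from comparing each chain at the indices
        \<open>n\<close> and \<open>n + n\<close>.\<close>
      have "(f ^^ n) ` (f ^^ n) ` A = (f ^^ n) ` A"
        using n(3)[of "n + n"] by (simp add: funpow_add image_comp)
      moreover have "inj_on (f ^^ n) ((f ^^ n) ` A)"
        using n(2)[of "n + n"] by (simp add: inj_on_funpow_image_iff)
      ultimately show "\<exists>n\<ge>1. (f ^^ n) ` A \<subseteq> (f ^^ n) ` (f ^^ n) ` A
          \<and> inj_on (f ^^ n) ((f ^^ n) ` A)"
        using n(1) by auto
    qed
  qed
qed

end
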